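(* Let $G=(V,E,c)$ be a directed graph that admits a circulation $C\colon E\to\mathbb N$ with $C(e)\ge1$ for all $e\in E$. For any circulation $X\colon E\to\mathbb Z$ with $\Vert X\Vert\le1$, there exist circulations $A,B\colon E\to\mathbb Z$ such that: (1) $A,B\ge0$; (2) $X=A-B$; (3) $\tilde c(A)+\tilde c(B)\le\mathrm{mccc}(G)$.
   Context: $G=(V,E,c)$ is a directed graph with no sources and no sinks, with a cost function $c\colon E\to\mathbb R_{\ge0}$. A circulation is a function $X$ on $E$ such that at every node the sum of values on incoming edges equals the sum of values on outgoing edges. $\Vert X\Vert=\max_{e\in E}|X(e)|$. The cost of a circulation $Y$ is $\tilde c(Y)=\sum_{e\in E}c(e)Y(e)$. $\mathrm{mccc}(G)$ (minimum cost circulation cover) is the minimum of $\tilde c(C)$ over all integer circulations $C$ on $G$ with $C(e)\ge1$ for all $e\in E$. *)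

theory Defs
  imports Complex_Main "HOL-Library.FuncSet" "Graph_Theory.Digraph"
begin

(* Functions on the arc set are total functions of which only the values on arcs G matter. *)

definition no_sources_sinks :: "('a, 'b) pre_digraph \<Rightarrow> bool" where
  "no_sources_sinks G \<longleftrightarrow> (\<forall>v \<in> verts G. in_arcs G v \<noteq> {} \<and> out_arcs G v \<noteq> {})"

definition circulation :: "('a, 'b) pre_digraph \<Rightarrow> ('b \<Rightarrow> 'c::comm_monoid_add) \<Rightarrow> bool" where
  "circulation G X \<longleftrightarrow> (\<forall>v \<in> verts G. (\<Sum>e \<in> in_arcs G v. X e) = (\<Sum>e \<in> out_arcs G v. X e))"

(* Inserting 0 only fixes the value on the graph without arcs, where Max would be applied
   to the empty set. *)
definition circ_norm :: "('a, 'b) pre_digraph \<Rightarrow> ('b \<Rightarrow> int) \<Rightarrow> int" where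
  "circ_norm G X = Max (insert 0 ((\<lambda>e. \<bar>X e\<bar>) ` arcs G))"

definition circ_cost :: "('a, 'b) pre_digraph \<Rightarrow> ('b \<Rightarrow> real) \<Rightarrow> ('b \<Rightarrow> int) \<Rightarrow> real" where
  "circ_cost G c Y = (\<Sum>e \<in> arcs G. c e * real_of_int (Y e))"

definition circulation_covers :: "('a, 'b) pre_digraph \<Rightarrow> ('b \<Rightarrow> int) set" where
  "circulation_covers G = {C. circulation G C \<and> (\<forall>e \<in> arcs G. 1 \<le> C e)}"

(* The least element exists whenever the graph is finite, the costs are nonnegative and some
   cover exists; see mccc_attained and mccc_le. *)
definition mccc :: "('a, 'b) pre_digraph \<Rightarrow> ('b \<Rightarrow> real) \<Rightarrow> real" where
  "mccc G c = (LEAST r. r \<in> circ_cost G c ` circulation_covers G)"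

context
  fixes G :: "('a, 'b) pre_digraph" and c :: "'b \<Rightarrow> real" and C :: "'b \<Rightarrow> int"
  assumes fin: "finite (arcs G)"
    and nonneg: "\<And>e. e \<in> arcs G \<Longrightarrow> 0 \<le> c e"
    and cover: "C \<in> circulation_covers G"
begin

lemma mccc_exists: "\<exists>m \<in> circ_cost G c ` circulation_covers G.
  \<forall>r \<in> circ_cost G c ` circulation_covers G. m \<le> r"
proof -
  define K where "K = circ_cost G c C"
  define S where "S = circ_cost G c ` circulation_covers G"
  define R where "R = (\<lambda>e. if c e = 0 then {0::int} else {0..\<lfloor>K / c e\<rfloor>})"
  have fT: "finite (circ_cost G c ` PiE (arcs G) R)"
    using fin by (intro finite_imageI finite_PiE) (auto simp: R_def)
  have "{r \<in> S. r \<le> K} \<subseteq> circ_cost G c ` PiE (arcs G) R"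
  proof
    fix r assume "r \<in> {r \<in> S. r \<le> K}"
    then obtain Y where Y: "Y \<in> circulation_covers G" "r = circ_cost G c Y" "r \<le> K"
      by (auto simp: S_def)
    define Z where "Z = restrict (\<lambda>e. if c e = 0 then 0 else Y e) (arcs G)"
    have pos: "1 \<le> Y e" if "e \<in> arcs G" for e
      using Y(1) that by (auto simp: circulation_covers_def)
    have "Y e \<le> \<lfloor>K / c e\<rfloor>" if e: "e \<in> arcs G" "c e \<noteq> 0" for e
    proof -
      have "c e * real_of_int (Y e) \<le> circ_cost G c Y"
        unfolding circ_cost_def
        by (rule member_le_sum) (use e fin nonneg pos in \<open>force intro!: mult_nonneg_nonneg\<close>)+
      with Y have "c e * real_of_int (Y e) \<le> K" by simp
      with nonneg[OF e(1)] e(2) show ?thesis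
        by (simp add: le_floor_iff pos_le_divide_eq mult.commute)
    qed
    with pos have "Z \<in> PiE (arcs G) R"
      by (force simp: Z_def R_def)
    moreover have "r = circ_cost G c Z"
      unfolding Y(2) circ_cost_def by (rule sum.cong) (auto simp: Z_def)
    ultimately show "r \<in> circ_cost G c ` PiE (arcs G) R" by blast
  qed
  then have f: "finite {r \<in> S. r \<le> K}" by (rule finite_subset[OF _ fT])
  have K: "K \<in> {r \<in> S. r \<le> K}" using cover by (auto simp: S_def K_def)
  let ?m = "Min {r \<in> S. r \<le> K}"
  have m: "?m \<in> {r \<in> S. r \<le> K}" using f K by (intro Min_in) auto
  moreover have "?m \<le> r" if "r \<in> S" for r
    using that f m by (cases "r \<le> K") (auto intro: Min_le)
  ultimately show ?thesis unfolding S_def by blast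
qed

lemma mccc_attained: "mccc G c \<in> circ_cost G c ` circulation_covers G"
  and mccc_le: "Y \<in> circulation_covers G \<Longrightarrow> mccc G c \<le> circ_cost G c Y"
proof -
  obtain m where m: "m \<in> circ_cost G c ` circulation_covers G"
    "\<forall>r \<in> circ_cost G c ` circulation_covers G. m \<le> r"
    using mccc_exists by blast
  then have "mccc G c = m" unfolding mccc_def by (intro Least_equality) auto
  with m show "mccc G c \<in> circ_cost G c ` circulation_covers G"
    "Y \<in> circulation_covers G \<Longrightarrow> mccc G c \<le> circ_cost G c Y" by auto
qed

end

end

(* Let C be a cheapest cover. The half-integral circulation (C + X) / 2 can be rounded to an
   integer circulation A without increasing the cost: the arcs on which C + X is odd form an
   undirected graph with all degrees even, and an Eulerian orientation of that graph tells which
   values to round up and which down; reversing it swaps the two roles, and one of the two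
   choices does not cost more. Then B = A - X is a rounding of (C - X) / 2, so both are
   nonnegative, and the cost of A + B = 2 A - X is at most that of C. *)

theory Submission
  imports Defs
begin

text \<open>The signed incidence matrix, with a zero column for every loop. It takes bare endpoint
  maps instead of a digraph so that an induction can redirect arcs.\<close>

definition incid :: "('b \<Rightarrow> 'a) \<Rightarrow> ('b \<Rightarrow> 'a) \<Rightarrow> 'b \<Rightarrow> 'a \<Rightarrow> int" where
  "incid h t e v = of_bool (h e = v) - of_bool (t e = v)"

(* Read s as an orientation: s e = -1 reverses the arc e. Induction step: two arcs e, f with a
   common endpoint are spliced into one arc, which takes the name f; the sign k records
   whether e has to be reversed for this. *)
lemma Eulerian_orientation:
  assumes "finite S" and "\<And>v. even (\<Sum>e\<in>S. incid h t e v)"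
  shows "\<exists>s :: 'b \<Rightarrow> int. (\<forall>e. s e = 1 \<or> s e = -1) \<and> (\<forall>v. (\<Sum>e\<in>S. s e * incid h t e v) = 0)"
  using assms
proof (induction S arbitrary: h t rule: finite_induct)
  case empty
  show ?case by (intro exI[of _ "\<lambda>_. 1"]) simp
next
  case (insert e S)
  show ?case
  proof (cases "h e = t e")
    case True
    then have "incid h t e v = 0" for v by (simp add: incid_def)
    with insert.IH[of h t] insert.prems insert.hyps show ?thesis by simp
  next
    case False
    then have "odd (incid h t e (h e))" by (simp add: incid_def)
    \<comment> \<open>The degree at \<open>h e\<close> is even and \<open>e\<close> contributes an
      odd amount, so some other arc \<open>f\<close>, not a loop, also ends there.\<close>
    with insert.prems[of "h e"] insert.hyps have "odd (\<Sum>f\<in>S. incid h t f (h e))" by simp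
    then obtain f where f: "f \<in> S" "odd (incid h t f (h e))"
      by (meson dvd_sum)
    obtain h' t' k where k: "k = 1 \<or> k = (-1::int)"
      and f': "\<And>v. incid h' t' f v = incid h t f v + k * incid h t e v"
      and other: "\<And>g v. g \<noteq> f \<Longrightarrow> incid h' t' g v = incid h t g v"
    proof (cases "t f = h e")
      case True
      show thesis
        by (rule that[of 1 h "t(f := t e)"]) (use True in \<open>auto simp: incid_def\<close>)
    next
      case False
      with f(2) have "h f = h e" by (auto simp: incid_def split: if_splits)
      then show thesis
        by (intro that[of "-1" "h(f := t e)" t]) (auto simp: incid_def)
    qed
    have splice: "(\<Sum>g\<in>S. s g * incid h' t' g v)
        = (\<Sum>g\<in>S. s g * incid h t g v) + s f * k * incid h t e v" for s v
    proof -
      have "(\<Sum>g\<in>S - {f}. s g * incid h' t' g v) = (\<Sum>g\<in>S - {f}. s g * incid h t g v)"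
        by (rule sum.cong) (auto simp: other)
      then show ?thesis
        by (simp add: sum.remove[OF insert.hyps(1) f(1)] f' algebra_simps)
    qed
    \<comment> \<open>As \<open>k\<close> is a sign, splicing alters the sum over
      \<open>insert e S\<close> at most by twice \<open>incid h t e v\<close>.\<close>
    have "even (\<Sum>g\<in>S. incid h' t' g v)" for v
      using splice[of "\<lambda>_. 1" v] insert.prems[of v] insert.hyps k by auto
    then obtain s where s: "\<And>e. s e = 1 \<or> s e = (-1::int)"
      "\<And>v. (\<Sum>g\<in>S. s g * incid h' t' g v) = 0"
      using insert.IH by blast
    \<comment> \<open>Undoing the splice: \<open>e\<close> follows the orientation of
      \<open>f\<close>, up to the sign \<open>k\<close>.\<close>
    define r where "r = s(e := s f * k)"
    have "(\<Sum>g\<in>S. r g * incid h t g v) = (\<Sum>g\<in>S. s g * incid h t g v)" for v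
      by (rule sum.cong) (use insert.hyps in \<open>auto simp: r_def\<close>)
    then have "(\<Sum>g\<in>insert e S. r g * incid h t g v) = 0" for v
      using splice[of s v] s(2)[of v] insert.hyps by (simp add: r_def)
    moreover have "r g = 1 \<or> r g = -1" for g
      using s(1)[of g] s(1)[of f] k by (auto simp: r_def)
    ultimately show ?thesis by blast
  qed
qed

text \<open>Loops cancel between the two arc sums, and outside \<open>verts G\<close> both sums are
  empty, so the balance may be required at every \<open>v\<close>.\<close>

lemma circulation_incid:
  fixes X :: "'b \<Rightarrow> int"
  assumes "fin_digraph G"
  shows "circulation G X \<longleftrightarrow> (\<forall>v. (\<Sum>e\<in>arcs G. X e * incid (head G) (tail G) e v) = 0)"
proof -
  interpret fin_digraph G by fact
  have eq: "(\<Sum>e\<in>arcs G. X e * incid (head G) (tail G) e v)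
      = (\<Sum>e\<in>in_arcs G v. X e) - (\<Sum>e\<in>out_arcs G v. X e)" for v
    by (simp add: incid_def in_arcs_def out_arcs_def right_diff_distrib sum_subtractf of_bool_def
        if_distrib[of "\<lambda>y. _ * y"] sum.inter_filter cong: if_cong)
  have "(\<Sum>e\<in>in_arcs G v. X e) = (\<Sum>e\<in>out_arcs G v. X e)" if "v \<notin> verts G" for v
  proof -
    from that have "in_arcs G v = {}" "out_arcs G v = {}"
      by (auto simp: in_arcs_def out_arcs_def)
    then show ?thesis by simp
  qed
  then show ?thesis by (auto simp: circulation_def eq)
qed

lemma circ_cost_add: "circ_cost G c (\<lambda>e. X e + Y e) = circ_cost G c X + circ_cost G c Y"
  by (simp add: circ_cost_def distrib_left sum.distrib)

lemma circ_cost_diff: "circ_cost G c (\<lambda>e. X e - Y e) = circ_cost G c X - circ_cost G c Y"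
  by (simp add: circ_cost_def right_diff_distrib sum_subtractf)

lemma circulation_add:
  fixes X Y :: "'b \<Rightarrow> int"
  shows "circulation G X \<Longrightarrow> circulation G Y \<Longrightarrow> circulation G (\<lambda>e. X e + Y e)"
  by (simp add: circulation_def sum.distrib)

lemma circulation_diff:
  fixes X Y :: "'b \<Rightarrow> int"
  shows "circulation G X \<Longrightarrow> circulation G Y \<Longrightarrow> circulation G (\<lambda>e. X e - Y e)"
  by (simp add: circulation_def sum_subtractf)

text \<open>\<open>s\<close> is twice the rounding error of \<open>H / 2\<close>. It comes from an
  orientation of the odd arcs; its negative serves equally well, and one of the two has nonpositive
  cost.\<close>

lemma circulation_rounding_signs:
  fixes H :: "'b \<Rightarrow> int"
  assumes "fin_digraph G" and "circulation G H"
  obtains s :: "'b \<Rightarrow> int" where "circulation G s" "circ_cost G c s \<le> 0"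
    "\<And>e. e \<in> arcs G \<Longrightarrow> \<bar>s e\<bar> \<le> 1 \<and> even (H e + s e)"
proof -
  interpret fin_digraph G by fact
  let ?d = "incid (head G) (tail G)"
  define S where "S = {e \<in> arcs G. odd (H e)}"
  have "even (\<Sum>e\<in>S. ?d e v)" for v
  proof -
    \<comment> \<open>The added sum is zero by conservation of \<open>H\<close>. Merging makes each
      term even: the factor of \<open>?d e v\<close> is \<open>H e + 1\<close> for odd
      \<open>H e\<close> and \<open>H e\<close> otherwise.\<close>
    have "(\<Sum>e\<in>S. ?d e v)
        = (\<Sum>e\<in>arcs G. if odd (H e) then ?d e v else 0) + (\<Sum>e\<in>arcs G. H e * ?d e v)"
      using assms by (simp add: S_def sum.inter_filter circulation_incid)
    also have "\<dots> = (\<Sum>e\<in>arcs G. (if odd (H e) then ?d e v else 0) + H e * ?d e v)"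
      by (simp add: sum.distrib)
    also have "even \<dots>"
      by (rule dvd_sum) auto
    finally show ?thesis .
  qed
  moreover have "finite S" by (simp add: S_def)
  ultimately obtain s0 where s0: "\<And>e. s0 e = 1 \<or> s0 e = (-1::int)"
    "\<And>v. (\<Sum>e\<in>S. s0 e * ?d e v) = 0"
    using Eulerian_orientation by blast
  define s where "s = (\<lambda>e. if odd (H e) then s0 e else 0)"
  have "(\<Sum>e\<in>arcs G. s e * ?d e v) = (\<Sum>e\<in>S. s0 e * ?d e v)" for v
    by (simp add: S_def sum.inter_filter s_def if_distrib[of "\<lambda>y. y * _"] cong: if_cong)
  then have circ: "circulation G s"
    using assms(1) by (simp add: circulation_incid s0)
  have round: "\<bar>s e\<bar> \<le> 1 \<and> even (H e + s e)" for e
    using s0(1)[of e] by (auto simp: s_def)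
  show thesis
  proof (cases "circ_cost G c s \<le> 0")
    case True
    with circ round that show thesis by blast
  next
    case False
    show thesis
    proof (rule that[of "\<lambda>e. - s e"])
      show "circulation G (\<lambda>e. - s e)"
        using circ by (simp add: circulation_def sum_negf)
      show "circ_cost G c (\<lambda>e. - s e) \<le> 0"
        using False by (simp add: circ_cost_def sum_negf)
      show "\<bar>- s e\<bar> \<le> 1 \<and> even (H e + - s e)" for e
        using round[of e] by simp
    qed
  qed
qed

lemma circulation_halving:
  fixes H :: "'b \<Rightarrow> int"
  assumes "fin_digraph G" and "circulation G H"
  obtains A :: "'b \<Rightarrow> int" where "circulation G A" "2 * circ_cost G c A \<le> circ_cost G c H"
    "\<And>e. e \<in> arcs G \<Longrightarrow> \<bar>2 * A e - H e\<bar> \<le> 1"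
proof -
  interpret fin_digraph G by fact
  obtain s :: "'b \<Rightarrow> int" where s: "circulation G s" "circ_cost G c s \<le> 0"
    "\<And>e. e \<in> arcs G \<Longrightarrow> \<bar>s e\<bar> \<le> 1 \<and> even (H e + s e)"
    using circulation_rounding_signs[OF assms] by blast
  define A where "A = (\<lambda>e. (H e + s e) div 2)"
  have A: "2 * A e = H e + s e" if "e \<in> arcs G" for e
    using s(3)[OF that] by (simp add: A_def)
  show thesis
  proof
    let ?d = "incid (head G) (tail G)"
    \<comment> \<open>Balance is checked on the doubled values, since \<open>div\<close> does not
      commute with sums.\<close>
    have "2 * (\<Sum>e\<in>arcs G. A e * ?d e v) = (\<Sum>e\<in>arcs G. (H e + s e) * ?d e v)" for v
      unfolding sum_distrib_left by (rule sum.cong) (simp_all flip: A)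
    then show "circulation G A"
      using circulation_add[OF assms(2) s(1)] assms(1) by (simp add: circulation_incid)
    have "2 * circ_cost G c A = circ_cost G c (\<lambda>e. H e + s e)"
      unfolding circ_cost_def sum_distrib_left by (rule sum.cong) (simp_all flip: A)
    then show "2 * circ_cost G c A \<le> circ_cost G c H"
      using s(2) by (simp add: circ_cost_add)
    show "\<bar>2 * A e - H e\<bar> \<le> 1" if "e \<in> arcs G" for e
      using A[OF that] s(3)[OF that] by simp
  qed
qed

theorem lemma23:
  fixes G :: "('a, 'b) pre_digraph" and c :: "'b \<Rightarrow> real" and X :: "'b \<Rightarrow> int"
  assumes "fin_digraph G"
    and "no_sources_sinks G"
    and "\<forall>e \<in> arcs G. 0 \<le> c e"
    and "\<exists>C :: 'b \<Rightarrow> nat. circulation G C \<and> (\<forall>e \<in> arcs G. 1 \<le> C e)"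
    and "circulation G X"
    and "circ_norm G X \<le> 1"
  shows "\<exists>A B :: 'b \<Rightarrow> int. circulation G A \<and> circulation G B
    \<and> (\<forall>e \<in> arcs G. 0 \<le> A e \<and> 0 \<le> B e)
    \<and> (\<forall>e \<in> arcs G. X e = A e - B e)
    \<and> circ_cost G c A + circ_cost G c B \<le> mccc G c"
proof -
  interpret fin_digraph G by fact
  obtain C0 :: "'b \<Rightarrow> nat" where C0: "circulation G C0" "\<forall>e \<in> arcs G. 1 \<le> C0 e"
    using assms(4) by blast
  then have "(\<lambda>e. int (C0 e)) \<in> circulation_covers G"
    by (force simp: circulation_covers_def circulation_def simp flip: of_nat_sum)
  from mccc_attained[OF _ _ this, of c] assms(3)
  obtain C where C: "circulation G C" "\<And>e. e \<in> arcs G \<Longrightarrow> 1 \<le> C e" "mccc G c = circ_cost G c C"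
    by (auto simp: circulation_covers_def)
  have X: "\<bar>X e\<bar> \<le> 1" if "e \<in> arcs G" for e
    using assms(6) that by (simp add: circ_norm_def)
  obtain A where A: "circulation G A" "2 * circ_cost G c A \<le> circ_cost G c (\<lambda>e. C e + X e)"
    "\<And>e. e \<in> arcs G \<Longrightarrow> \<bar>2 * A e - (C e + X e)\<bar> \<le> 1"
    using circulation_halving[OF assms(1) circulation_add[OF C(1) assms(5)]] by blast
  \<comment> \<open>Both \<open>C e + X e\<close> and \<open>C e - X e\<close> are nonnegative, so
    \<open>2 * A e\<close> and \<open>2 * (A e - X e)\<close> are at least -1, and integrality gives
    the rest.\<close>
  have "0 \<le> A e \<and> 0 \<le> A e - X e" if "e \<in> arcs G" for e
    using A(3)[OF that] X[OF that] C(2)[OF that] by arith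
  moreover have "circ_cost G c A + circ_cost G c (\<lambda>e. A e - X e) \<le> mccc G c"
    using A(2) C(3) by (simp add: circ_cost_add circ_cost_diff)
  ultimately show ?thesis
    using A(1) circulation_diff[OF A(1) assms(5)]
    by (intro exI[of _ A] exI[of _ "\<lambda>e. A e - X e"]) simp
qed

end
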